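(* Let $f:\mathbb{R}^d\to\mathbb{R}$ and $g:\mathbb{R}^d\to\mathbb{R}$, and let $f^{\wedge g}:\mathbb{R}\to\overline{\mathbb{R}}$ be defined by $f^{\wedge g}(s)=\inf\{f(x) : x\in\mathbb{R}^d,\ s\le g(x)\}$. Then one has $f^{\wedge g}(0)=0$ and $f^{\wedge g}(s)>0$ for all $s>0$ if and only if the three following statements hold: 1. for every $s>0$ there exists $b_s>0$ such that $\{x\in\mathbb{R}^d : g(x)\ge s\}\subseteq\{x\in\mathbb{R}^d : f(x)\ge b_s\}$; 2. the set $\{x\in\mathbb{R}^d : g(x)\ge 0\}$ is nonempty and included in $\{x\in\mathbb{R}^d : f(x)\ge 0\}$; 3. there exists a sequence $(x_n)_{n\in\mathbb{N}}$ in $\{x\in\mathbb{R}^d : g(x)\ge 0\}$ such that $\lim_{n\to+\infty} f(x_n)=0$.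
   Context: $\overline{\mathbb{R}}=\mathbb{R}\cup\{-\infty,+\infty\}$; the infimum over the empty set is $+\infty$. *)

theory Defs
  imports "HOL-Analysis.Analysis"
begin

(* Written f^{\<and>g}(s) in the literature; the value is \<infinity> when no x satisfies s \<le> g x. *)
definition constrained_inf ::
    "(real ^ 'd \<Rightarrow> real) \<Rightarrow> (real ^ 'd \<Rightarrow> real) \<Rightarrow> real \<Rightarrow> ereal" where
  "constrained_inf f g s = Inf {ereal (f x) | x. s \<le> g x}"

end

theory Submission
  imports Defs
begin

text \<open>Both properties of the infimum translate separately into statements about superlevel
  sets. A real \<open>b\<close> is a lower bound of the values exactly when one superlevel set lies
  in another (\<open>ereal_le_constrained_inf_iff\<close>). Positivity of the infimum means that
  some real \<open>b > 0\<close> is such a bound (\<open>constrained_inf_pos_iff\<close>). The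
  infimum is a real \<open>c\<close> exactly when \<open>c\<close> is a lower bound and a limit of
  attained values (\<open>constrained_inf_eq_iff\<close>); at \<open>s = 0\<close>,
  \<open>c = 0\<close>, the terms of the approximating sequence witness that the feasible set is
  nonempty.\<close>

lemma ereal_le_constrained_inf_iff:
  "ereal b \<le> constrained_inf f g s \<longleftrightarrow> {x. g x \<ge> s} \<subseteq> {x. f x \<ge> b}"
  by (auto simp: constrained_inf_def le_Inf_iff)

lemma constrained_inf_le: "s \<le> g x \<Longrightarrow> constrained_inf f g s \<le> ereal (f x)"
  by (auto simp: constrained_inf_def intro: Inf_lower)

lemma constrained_inf_less_iff:
  "constrained_inf f g s < ereal b \<longleftrightarrow> (\<exists>x. s \<le> g x \<and> f x < b)"
  by (auto simp: constrained_inf_def Inf_less_iff)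

lemma constrained_inf_pos_iff:
  "0 < constrained_inf f g s \<longleftrightarrow> (\<exists>b>0. {x. g x \<ge> s} \<subseteq> {x. f x \<ge> b})"
proof
  assume "0 < constrained_inf f g s"
  \<comment> \<open>A real strictly below the infimum exists even when the infimum is \<infinity>,
    as happens for an empty feasible set.\<close>
  then obtain b where "0 < ereal b" "ereal b < constrained_inf f g s"
    using ereal_dense2 by blast
  then show "\<exists>b>0. {x. g x \<ge> s} \<subseteq> {x. f x \<ge> b}"
    by (metis ereal_le_constrained_inf_iff ereal_less(2) less_imp_le)
next
  assume "\<exists>b>0. {x. g x \<ge> s} \<subseteq> {x. f x \<ge> b}"
  then show "0 < constrained_inf f g s"
    by (metis ereal_le_constrained_inf_iff ereal_less(2) less_le_trans)
qed

text \<open>The sequence expresses that \<open>c\<close> is the greatest lower bound; it also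
  excludes an empty feasible set, where the infimum would be \<infinity>.\<close>

lemma constrained_inf_eq_iff:
  "constrained_inf f g s = ereal c \<longleftrightarrow>
    {x. g x \<ge> s} \<subseteq> {x. f x \<ge> c} \<and> (\<exists>x. (\<forall>n. s \<le> g (x n)) \<and> (\<lambda>n. f (x n)) \<longlonglongrightarrow> c)"
proof (intro iffI conjI)
  assume inf: "constrained_inf f g s = ereal c"
  then show sub: "{x. g x \<ge> s} \<subseteq> {x. f x \<ge> c}"
    by (simp flip: ereal_le_constrained_inf_iff)
  \<comment> \<open>Since \<open>c\<close> is finite, \<open>c + inverse (real (Suc n))\<close> lies
    strictly above the infimum, so some feasible value falls below it.\<close>
  have "\<exists>x. s \<le> g x \<and> f x < c + inverse (real (Suc n))" for n
    unfolding constrained_inf_less_iff[symmetric] inf by simp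
  then obtain x where x: "s \<le> g (x n)" "f (x n) < c + inverse (real (Suc n))" for n
    by metis
  have "(\<lambda>n. f (x n)) \<longlonglongrightarrow> c"
  proof (rule tendsto_sandwich[OF _ _ tendsto_const LIMSEQ_inverse_real_of_nat_add])
    show "\<forall>\<^sub>F n in sequentially. c \<le> f (x n)"
      using sub x(1) by (intro always_eventually) blast
    show "\<forall>\<^sub>F n in sequentially. f (x n) \<le> c + inverse (real (Suc n))"
      by (intro always_eventually allI less_imp_le x(2))
  qed
  with x(1) show "\<exists>x. (\<forall>n. s \<le> g (x n)) \<and> (\<lambda>n. f (x n)) \<longlonglongrightarrow> c"
    by blast
next
  assume *: "{x. g x \<ge> s} \<subseteq> {x. f x \<ge> c} \<and>
    (\<exists>x. (\<forall>n. s \<le> g (x n)) \<and> (\<lambda>n. f (x n)) \<longlonglongrightarrow> c)"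
  then obtain x where x: "\<And>n. s \<le> g (x n)" and lim: "(\<lambda>n. f (x n)) \<longlonglongrightarrow> c"
    by blast
  \<comment> \<open>The infimum is below every \<open>f (x n)\<close>, hence below their
    limit.\<close>
  have "constrained_inf f g s \<le> ereal c"
    by (rule tendsto_lowerbound[OF tendsto_ereal[OF lim]])
      (simp_all add: constrained_inf_le x)
  moreover have "ereal c \<le> constrained_inf f g s"
    using * by (simp add: ereal_le_constrained_inf_iff)
  ultimately show "constrained_inf f g s = ereal c"
    by (rule antisym)
qed

theorem proposition6:
  fixes f g :: "real ^ 'd \<Rightarrow> real"
  shows "(constrained_inf f g 0 = 0 \<and> (\<forall>s>0. constrained_inf f g s > 0)) \<longleftrightarrow>
    (\<forall>s>0. \<exists>b>0. {x. g x \<ge> s} \<subseteq> {x. f x \<ge> b}) \<and>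
    ({x. g x \<ge> 0} \<noteq> {} \<and> {x. g x \<ge> 0} \<subseteq> {x. f x \<ge> 0}) \<and>
    (\<exists>x :: nat \<Rightarrow> real ^ 'd. (\<forall>n. x n \<in> {y. g y \<ge> 0}) \<and> (\<lambda>n. f (x n)) \<longlonglongrightarrow> 0)"
proof -
  \<comment> \<open>The extended real \<open>0\<close> is put into the form \<open>ereal c\<close>
    so that \<open>constrained_inf_eq_iff\<close> rewrites it.\<close>
  have "constrained_inf f g 0 = 0 \<longleftrightarrow> constrained_inf f g 0 = ereal 0"
    by (simp add: zero_ereal_def)
  then show ?thesis
    unfolding constrained_inf_pos_iff constrained_inf_eq_iff by auto
qed

end
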